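(* Let $\mathbb{X}\subseteq\mathbb{R}^n$ be open, let $\bar x\in\mathbb{X}$, and let $\omega$ be a size function for $(\mathbb{X},\bar x)$. Let $V:\mathbb{X}\to\mathbb{R}$ be continuously differentiable such that $V-V(\bar x)$ is a size function for $(\mathbb{X},\bar x)$, $\nabla V$ is locally Lipschitz, and $x\mapsto|\nabla V(x)|$ is a size function for $(\mathbb{X},\bar x)$. Let $B:\mathbb{X}\to\mathbb{R}^{n\times m}$ be a bounded mapping, and let $f:\mathbb{X}\times\mathbb{R}^m\to\mathbb{X}$, $f(x,u)=F(x,B(x)u)$, where $F$ is the perturbed steepest descent step map associated to $V$. Then the discrete-time system $x^+=f(x,u)$ is input to state stable (ISS) on $\mathbb{X}$ with respect to $\bar x$, and $V$ is an ISS-Lyapunov function for it.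
   Context: Notation: $|\cdot|$ is the Euclidean norm; $\nabla V$ is the gradient written as a row vector, $T$ denotes transpose. $\mathcal{K}$ is the set of continuous, strictly increasing $\alpha:[0,\infty)\to[0,\infty)$ with $\alpha(0)=0$; $\mathcal{K}_\infty$ is the set of unbounded elements of $\mathcal{K}$. A function $\beta:[0,\infty)\times[0,\infty)\to[0,\infty)$ is of class $\mathcal{KL}$ if $\beta(\cdot,t)\in\mathcal{K}$ for each fixed $t$, and for each fixed $r$, $\beta(r,t)$ decreases (is nonincreasing in $t$) to $0$ as $t\to\infty$. Size function: $\omega:\mathbb{X}\to\mathbb{R}$ is a size function for $(\mathbb{X},\bar x)$ if it is continuous, positive definite with respect to $\bar x$ ($\omega(\bar x)=0$ and $\omega(x)>0$ for $x\in\mathbb{X}$, $x\ne\bar x$), and proper (for every real $r\ge0$ the sublevel set $\{x\in\mathbb{X}: \omega(x)\le r\}$ is a compact subset of $\mathbb{X}$). Steepest descent step map $F:\mathbb{X}\times\mathbb{R}^n\to\mathbb{X}$: given $x^0\in\mathbb{X}$ and $q\in\mathbb{R}^n$, put $p=\nabla V(x^0)^T$. If $p+q=0$, set $F(x^0,q)=x^0$. If $p+q\neq0$, let $\Lambda(x^0,q)$ be the set of $\lambda\ge0$ such that for all $\mu\in[0,\lambda]$ one has $x^0-\mu(p+q)\in\mathbb{X}$ and $V(x^0-\mu(p+q))\le V(x^0)$ (this set is compact and contains $0$); let $\bar\lambda_{x^0,q}$ be the smallest $\lambda\in\Lambda(x^0,q)$ at which $\lambda\mapsto V(x^0-\lambda(p+q))$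 attains its minimum over $\Lambda(x^0,q)$; and set $F(x^0,q)=x^0-\bar\lambda_{x^0,q}(p+q)$. Discrete-time ISS: for a bounded input sequence $u=(u_0,u_1,\ldots)$ in $\mathbb{R}^m$, put $\|u\|_\infty=\sup_{t\ge0}|u_t|$; for $x^0\in\mathbb{X}$ let $x(t,x^0,u)$, $t=0,1,2,\ldots$, be defined by $x(0,x^0,u)=x^0$ and $x(t+1,x^0,u)=f(x(t,x^0,u),u_t)$. The system is ISS (on $\mathbb{X}$, with respect to $\bar x$) if there exist $\beta\in\mathcal{KL}$ and $\gamma\in\mathcal{K}_\infty$ such that $\omega(x(t,x^0,u))\le\beta(\omega(x^0),t)+\gamma(\|u\|_\infty)$ for all bounded input sequences $u$, all $x^0\in\mathbb{X}$ and all $t=0,1,2,\ldots$. (Continuity of $f$ is not part of this property.) Discrete-time ISS-Lyapunov function for $x^+=f(x,u)$: a continuous $V:\mathbb{X}\to\mathbb{R}$ such that (a) $V-V(\bar x)$ is a size function for $(\mathbb{X},\bar x)$, and (b) there exist a continuous positive definite function $\alpha:[0,\infty)\to[0,\infty)$ (i.e. $\alpha(0)=0$ and $\alpha(r)>0$ for $r>0$) and a function $\chi\in\mathcal{K}_\infty$ such that for all $x\in\mathbb{X}$, $u\in\mathbb{R}^m$: $\omega(x)\ge\chi(|u|)$ implies $V(f(x,u))-V(x)\le-\alpha(V(x)-V(\bar x))$. *)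

theory Defs
  imports "HOL-Analysis.Analysis"
begin

text \<open>Functions with domain \<open>X\<close> or \<open>[0,\<infinity>)\<close> are total functions here; only their values on \<open>X\<close>,
  respectively on \<open>{0..}\<close>, are ever constrained or used.\<close>

subsection \<open>Comparison functions\<close>

text \<open>Values are nonnegative automatically, since \<open>\<alpha> 0 = 0\<close> and \<open>\<alpha>\<close> is increasing.\<close>

definition class_K :: "(real \<Rightarrow> real) \<Rightarrow> bool" where
  "class_K \<alpha> \<longleftrightarrow> continuous_on {0..} \<alpha> \<and> strict_mono_on {0..} \<alpha> \<and> \<alpha> 0 = 0"

definition class_K_inf :: "(real \<Rightarrow> real) \<Rightarrow> bool" where
  "class_K_inf \<alpha> \<longleftrightarrow> class_K \<alpha> \<and> \<not> bounded (\<alpha> ` {0..})"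

definition class_KL :: "(real \<Rightarrow> real \<Rightarrow> real) \<Rightarrow> bool" where
  "class_KL \<beta> \<longleftrightarrow>
     (\<forall>t\<ge>0. class_K (\<lambda>r. \<beta> r t)) \<and>
     (\<forall>r\<ge>0. antimono_on {0..} (\<beta> r) \<and> (\<beta> r \<longlongrightarrow> 0) at_top)"

definition pos_def_fun :: "(real \<Rightarrow> real) \<Rightarrow> bool" where
  "pos_def_fun \<alpha> \<longleftrightarrow> continuous_on {0..} \<alpha> \<and> \<alpha> 0 = 0 \<and> (\<forall>r>0. \<alpha> r > 0)"

definition size_function :: "'a::metric_space set \<Rightarrow> 'a \<Rightarrow> ('a \<Rightarrow> real) \<Rightarrow> bool" where
  "size_function X xbar \<omega> \<longleftrightarrow>
     continuous_on X \<omega> \<and>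
     \<omega> xbar = 0 \<and> (\<forall>x\<in>X. x \<noteq> xbar \<longrightarrow> \<omega> x > 0) \<and>
     (\<forall>r\<ge>0. compact {x \<in> X. \<omega> x \<le> r})"


subsection \<open>Gradients and regularity\<close>

text \<open>The gradient as a column vector, i.e. the transpose of the row vector \<open>\<nabla>V(x)\<close>.\<close>

definition gradient :: "('a::real_inner \<Rightarrow> real) \<Rightarrow> 'a \<Rightarrow> 'a" where
  "gradient V x = (THE D. GDERIV V x :> D)"

text \<open>Intended for open \<open>X\<close>, where \<open>differentiable_on\<close> means differentiable at every point.\<close>

definition continuously_differentiable_on :: "('a::real_inner \<Rightarrow> real) \<Rightarrow> 'a set \<Rightarrow> bool" where
  "continuously_differentiable_on V X \<longleftrightarrow> V differentiable_on X \<and> continuous_on X (gradient V)"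

text \<open>The library notion concerns families of maps indexed by a time parameter; here the
  family is constant.\<close>

definition locally_lipschitz_on :: "'a::metric_space set \<Rightarrow> ('a \<Rightarrow> 'b::metric_space) \<Rightarrow> bool" where
  "locally_lipschitz_on X g \<longleftrightarrow> local_lipschitz (UNIV::real set) X (\<lambda>_. g)"

lemma locally_lipschitz_on_iff:
  "locally_lipschitz_on X g \<longleftrightarrow> (\<forall>x\<in>X. \<exists>u>0. \<exists>L. L-lipschitz_on (cball x u \<inter> X) g)"
  unfolding locally_lipschitz_on_def local_lipschitz_def
  by (metis (no_types, lifting) IntI UNIV_I centre_in_cball less_eq_real_def)

lemma gradient_eqI:
  assumes "GDERIV V x :> D"
  shows "gradient V x = D"
  unfolding gradient_def
proof (rule the_equality)
  show "GDERIV V x :> D" by fact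
  fix E assume "GDERIV V x :> E"
  then have "(\<lambda>h. h \<bullet> E) = (\<lambda>h. h \<bullet> D)"
    using assms unfolding gderiv_def by (rule has_derivative_unique)
  then show "E = D"
    by (metis inner_commute vector_eq_rdot)
qed

lemma GDERIV_gradient:
  fixes V :: "'a::euclidean_space \<Rightarrow> real"
  assumes "V differentiable (at x)"
  shows "GDERIV V x :> gradient V x"
proof -
  obtain V' where V': "(V has_derivative V') (at x)"
    using assms by (auto simp: differentiable_def)
  define D where "D = (\<Sum>b\<in>Basis. V' b *\<^sub>R b)"
  have "V' h = h \<bullet> D" for h
  proof -
    have "V' h = V' (\<Sum>b\<in>Basis. (h \<bullet> b) *\<^sub>R b)"
      by (simp add: euclidean_representation)
    also have "\<dots> = (\<Sum>b\<in>Basis. (h \<bullet> b) * V' b)"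
      using has_derivative_linear[OF V'] by (simp add: linear_sum linear_scale)
    finally show ?thesis
      by (simp add: D_def inner_sum_right mult.commute)
  qed
  then have "V' = (\<lambda>h. h \<bullet> D)" by auto
  then have "GDERIV V x :> D"
    using V' by (simp add: gderiv_def)
  with gradient_eqI[OF this] show ?thesis by simp
qed


subsection \<open>The perturbed steepest descent step\<close>

definition step_set :: "'a::real_inner set \<Rightarrow> ('a \<Rightarrow> real) \<Rightarrow> 'a \<Rightarrow> 'a \<Rightarrow> real set" where
  "step_set X V x q =
     {l. l \<ge> 0 \<and> (\<forall>\<mu>\<in>{0..l}.
        x - \<mu> *\<^sub>R (gradient V x + q) \<in> X \<and> V (x - \<mu> *\<^sub>R (gradient V x + q)) \<le> V x)}"

definition step_length :: "'a::real_inner set \<Rightarrow> ('a \<Rightarrow> real) \<Rightarrow> 'a \<Rightarrow> 'a \<Rightarrow> real" where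
  "step_length X V x q =
     (LEAST l. is_arg_min (\<lambda>l. V (x - l *\<^sub>R (gradient V x + q))) (\<lambda>l. l \<in> step_set X V x q) l)"

definition descent_step :: "'a::real_inner set \<Rightarrow> ('a \<Rightarrow> real) \<Rightarrow> 'a \<Rightarrow> 'a \<Rightarrow> 'a" where
  "descent_step X V x q =
     (if gradient V x + q = 0 then x
      else x - step_length X V x q *\<^sub>R (gradient V x + q))"

text \<open>The step is well defined: the step set is compact and contains \<open>0\<close>, the least minimizer
  exists, and the step maps \<open>X\<close> into itself.\<close>

lemma step_set_compact:
  fixes X :: "'a::euclidean_space set"
  assumes "continuous_on X V" and "compact {y \<in> X. V y \<le> V x}" and "gradient V x + q \<noteq> 0"
  shows "compact (step_set X V x q)"
proof -
  define d where "d = gradient V x + q"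
  define S where "S = {y \<in> X. V y \<le> V x}"
  have d: "d \<noteq> 0" using assms(3) by (simp add: d_def)
  have S: "compact S" using assms(2) by (simp add: S_def)
  have eq: "step_set X V x q = {l. l \<ge> 0 \<and> (\<forall>\<mu>\<in>{0..l}. x - \<mu> *\<^sub>R d \<in> S)}"
    by (auto simp: step_set_def d_def S_def)
  have clM: "closed {\<mu>::real. x - \<mu> *\<^sub>R d \<in> S}"
    using closed_vimage[OF compact_imp_closed[OF S], of "\<lambda>\<mu>. x - \<mu> *\<^sub>R d"]
    by (simp add: vimage_def continuous_intros)
  have "closed (step_set X V x q)"
    unfolding closed_sequential_limits
  proof (intro allI impI, elim conjE)
    fix s l assume s: "\<forall>n. s n \<in> step_set X V x q" and lim: "s \<longlonglongrightarrow> l"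
    have l0: "l \<ge> 0"
      using s by (intro LIMSEQ_le_const[OF lim]) (auto simp: eq)
    have "x - \<mu> *\<^sub>R d \<in> S" if \<mu>: "0 \<le> \<mu>" "\<mu> \<le> l" for \<mu>
    proof -
      have "(\<lambda>n. min \<mu> (s n)) \<longlonglongrightarrow> min \<mu> l"
        by (intro tendsto_intros lim)
      then have lim': "(\<lambda>n. min \<mu> (s n)) \<longlonglongrightarrow> \<mu>" using \<mu> by (simp add: min_absorb1)
      have "min \<mu> (s n) \<in> {\<mu>. x - \<mu> *\<^sub>R d \<in> S}" for n
      proof -
        have "min \<mu> (s n) \<in> {0..s n}" using s \<mu> by (auto simp: eq)
        moreover have "\<forall>\<mu>\<in>{0..s n}. x - \<mu> *\<^sub>R d \<in> S" using s unfolding eq by blast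
        ultimately show ?thesis by blast
      qed
      then show ?thesis
        using closed_sequentially[OF clM _ lim'] by blast
    qed
    then show "l \<in> step_set X V x q" using l0 by (simp add: eq)
  qed
  moreover have "bounded (step_set X V x q)"
  proof -
    obtain K where K: "\<And>y. y \<in> S \<Longrightarrow> norm y \<le> K"
      using compact_imp_bounded[OF S] by (auto simp: bounded_iff)
    have "norm l \<le> (norm x + K) / norm d" if l: "l \<in> step_set X V x q" for l
    proof -
      have l0: "l \<ge> 0" and mem: "x - l *\<^sub>R d \<in> S" using l by (auto simp: eq)
      have "l * norm d = norm (x - (x - l *\<^sub>R d))" using l0 by simp
      also have "\<dots> \<le> norm x + norm (x - l *\<^sub>R d)" by (rule norm_triangle_ineq4)
      also have "\<dots> \<le> norm x + K" using K[OF mem] by simp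
      finally show ?thesis using d l0 by (simp add: pos_le_divide_eq)
    qed
    then show ?thesis by (auto simp: bounded_iff)
  qed
  ultimately show ?thesis by (simp add: compact_eq_bounded_closed)
qed

lemma zero_in_step_set: "x \<in> X \<Longrightarrow> 0 \<in> step_set X V x q"
  by (simp add: step_set_def)

lemma step_length_props:
  fixes X :: "'a::euclidean_space set"
  assumes cont: "continuous_on X V" and cpt: "compact {y \<in> X. V y \<le> V x}"
    and nz: "gradient V x + q \<noteq> 0" and x: "x \<in> X"
  defines "P \<equiv> is_arg_min (\<lambda>l. V (x - l *\<^sub>R (gradient V x + q))) (\<lambda>l. l \<in> step_set X V x q)"
  shows "P (step_length X V x q)" and "P l \<Longrightarrow> step_length X V x q \<le> l"
proof -
  let ?L = "step_set X V x q"
  define g where "g = (\<lambda>l. V (x - l *\<^sub>R (gradient V x + q)))"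
  have L: "compact ?L" by (rule step_set_compact[OF cont cpt nz])
  have gc: "continuous_on ?L g"
    unfolding g_def
    by (rule continuous_on_compose2[OF cont]) (auto intro!: continuous_intros simp: step_set_def)
  obtain m where m: "m \<in> ?L" "\<And>l. l \<in> ?L \<Longrightarrow> g m \<le> g l"
    using continuous_attains_inf[OF L _ gc] zero_in_step_set[OF x] by blast
  have P: "P l \<longleftrightarrow> l \<in> ?L \<and> g l \<le> g m" for l
    using m unfolding P_def is_arg_min_def g_def[symmetric] by (metis g_def linorder_not_less order_trans)
  have "closedin (top_of_set ?L) (?L \<inter> g -` {..g m})"
    by (rule continuous_closedin_preimage[OF gc]) simp
  then have "compact (?L \<inter> g -` {..g m})"
    using L closedin_compact by blast
  moreover have "m \<in> ?L \<inter> g -` {..g m}" using m by simp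
  ultimately obtain l0 where l0: "l0 \<in> ?L \<inter> g -` {..g m}"
    "\<And>l. l \<in> ?L \<inter> g -` {..g m} \<Longrightarrow> l0 \<le> l"
    using compact_attains_inf[of "?L \<inter> g -` {..g m}"] by blast
  have "step_length X V x q = l0"
    unfolding step_length_def P_def[symmetric]
    by (rule Least_equality) (use l0 P in auto)
  then show "P (step_length X V x q)" "P l \<Longrightarrow> step_length X V x q \<le> l"
    using l0 P by auto
qed

lemma descent_step_in:
  fixes X :: "'a::euclidean_space set"
  assumes "size_function X xbar (\<lambda>x. V x - V xbar)" and "x \<in> X"
  shows "descent_step X V x q \<in> X"
proof (cases "gradient V x + q = 0")
  case False
  have "continuous_on X (\<lambda>x. V x - V xbar)"
    using assms(1) unfolding size_function_def by blast
  from continuous_on_add[OF this continuous_on_const[of X "V xbar"]]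
  have cont: "continuous_on X V" by simp
  have "V x - V xbar \<ge> 0"
    using assms unfolding size_function_def by (cases "x = xbar") (auto simp: less_imp_le)
  then have "compact {y \<in> X. V y - V xbar \<le> V x - V xbar}"
    using assms(1) unfolding size_function_def by blast
  then have cpt: "compact {y \<in> X. V y \<le> V x}" by simp
  show ?thesis
    using step_length_props(1)[OF cont cpt False assms(2)] False
    by (auto simp: descent_step_def is_arg_min_def step_set_def)
qed (use assms in \<open>simp add: descent_step_def\<close>)



subsection \<open>Discrete-time systems\<close>

primrec trajectory :: "('a \<Rightarrow> 'u \<Rightarrow> 'a) \<Rightarrow> 'a \<Rightarrow> (nat \<Rightarrow> 'u) \<Rightarrow> nat \<Rightarrow> 'a" where
  "trajectory f x u 0 = x"
| "trajectory f x u (Suc t) = f (trajectory f x u t) (u t)"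

text \<open>The base point enters the next definition only through the size function \<open>\<omega>\<close>.\<close>

definition ISS :: "'a set \<Rightarrow> ('a \<Rightarrow> real) \<Rightarrow> ('a \<Rightarrow> 'u::real_normed_vector \<Rightarrow> 'a) \<Rightarrow> bool" where
  "ISS X \<omega> f \<longleftrightarrow>
     (\<exists>\<beta> \<gamma>. class_KL \<beta> \<and> class_K_inf \<gamma> \<and>
       (\<forall>u. bounded (range u) \<longrightarrow> (\<forall>x\<in>X. \<forall>t::nat.
          \<omega> (trajectory f x u t) \<le> \<beta> (\<omega> x) (real t) + \<gamma> (SUP s. norm (u s)))))"

definition ISS_Lyapunov_function ::
  "'a::metric_space set \<Rightarrow> 'a \<Rightarrow> ('a \<Rightarrow> real) \<Rightarrow> ('a \<Rightarrow> 'u::real_normed_vector \<Rightarrow> 'a) \<Rightarrow> ('a \<Rightarrow> real) \<Rightarrow> bool"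
where
  "ISS_Lyapunov_function X xbar \<omega> f V \<longleftrightarrow>
     continuous_on X V \<and>
     size_function X xbar (\<lambda>x. V x - V xbar) \<and>
     (\<exists>\<alpha> \<rho>. pos_def_fun \<alpha> \<and> class_K_inf \<rho> \<and>
       (\<forall>x\<in>X. \<forall>u. \<omega> x \<ge> \<rho> (norm u) \<longrightarrow> V (f x u) - V x \<le> - \<alpha> (V x - V xbar)))"

end

theory Submission
  imports Defs
begin

text \<open>A perturbation \<open>q\<close> with \<open>|q| \<le> |\<nabla>V(x)| / 2\<close> leaves a descent direction. On the compact sublevel
  sets of \<open>V\<close> the gradient is Lipschitz, say with constant \<open>L\<close>, so the step of length \<open>1 / (9 L)\<close>
  is admissible and lowers \<open>V\<close> by at least \<open>|\<nabla>V(x)|\<^sup>2 / (36 L)\<close>; the minimizing step does no worse.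
  As \<open>|\<nabla>V|\<close> and \<open>\<omega>\<close> are comparable size functions and \<open>B\<close> is bounded, \<open>q = B(x) u\<close> is that small
  once \<open>\<omega>(x)\<close> is large compared with \<open>|u|\<close>, so \<open>V\<close> is an ISS-Lyapunov function.
  Even for large \<open>q\<close> a step never raises \<open>V\<close>. Hence a trajectory that has once entered the
  region where \<open>u\<close> dominates keeps the resulting bound on \<open>V\<close>, and until then \<open>V\<close> decreases at a
  uniform rate, which gives ISS.\<close>

subsection \<open>Comparison functions\<close>

lemma class_K_strict:
  assumes "class_K \<alpha>" "0 \<le> r" "r < s"
  shows "\<alpha> r < \<alpha> s"
  using assms unfolding class_K_def by (auto intro: strict_mono_onD)

lemma class_K_mono:
  assumes "class_K \<alpha>" "0 \<le> r" "r \<le> s"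
  shows "\<alpha> r \<le> \<alpha> s"
  using class_K_strict[of \<alpha> r s] assms by (cases "r = s") auto

lemma class_K_nonneg: "class_K \<alpha> \<Longrightarrow> 0 \<le> r \<Longrightarrow> 0 \<le> \<alpha> r"
  using class_K_mono[of \<alpha> 0 r] by (simp add: class_K_def)

lemma class_K_inf_iff: "class_K_inf \<alpha> \<longleftrightarrow> class_K \<alpha> \<and> (\<forall>C. \<exists>r\<ge>0. \<alpha> r > C)"
proof -
  have "bounded (\<alpha> ` {0..}) \<longleftrightarrow> (\<exists>C. \<forall>r\<ge>0. \<alpha> r \<le> C)" if "class_K \<alpha>"
    using class_K_nonneg[OF that] by (auto simp: bounded_iff)
  then show ?thesis
    unfolding class_K_inf_def by (meson not_le)
qed

lemma class_K_inf_compose: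
  assumes "class_K_inf \<alpha>" "class_K_inf \<delta>"
  shows "class_K_inf (\<lambda>r. \<alpha> (\<delta> r))"
proof -
  have K: "class_K \<alpha>" "class_K \<delta>" using assms by (auto simp: class_K_inf_def)
  have "class_K (\<lambda>r. \<alpha> (\<delta> r))"
    unfolding class_K_def
  proof (intro conjI)
    show "continuous_on {0..} (\<lambda>r. \<alpha> (\<delta> r))"
      by (rule continuous_on_compose2[of "{0..}" \<alpha>])
        (use K class_K_nonneg[OF K(2)] in \<open>auto simp: class_K_def\<close>)
    show "strict_mono_on {0..} (\<lambda>r. \<alpha> (\<delta> r))"
      using class_K_nonneg[OF K(2)] by (auto intro!: strict_mono_onI class_K_strict[OF K(1)] class_K_strict[OF K(2)])
    show "\<alpha> (\<delta> 0) = 0" using K by (simp add: class_K_def)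
  qed
  moreover have "\<exists>r\<ge>0. \<alpha> (\<delta> r) > C" for C
  proof -
    obtain s where s: "s \<ge> 0" "\<alpha> s > C" using assms(1) class_K_inf_iff by blast
    obtain r where r: "r \<ge> 0" "\<delta> r > s" using assms(2) class_K_inf_iff by blast
    show ?thesis using class_K_mono[OF K(1) s(1), of "\<delta> r"] r s by (intro exI[of _ r]) auto
  qed
  ultimately show ?thesis by (simp add: class_K_inf_iff)
qed

lemma class_K_inf_mult:
  assumes "c > 0"
  shows "class_K_inf (\<lambda>r. c * r)"
proof -
  have "\<exists>r\<ge>0. c * r > C" for C
    using assms by (intro exI[of _ "(\<bar>C\<bar> + 1) / c"]) auto
  then show ?thesis using assms
    by (auto simp: class_K_inf_iff class_K_def intro!: continuous_intros strict_mono_onI)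
qed

text \<open>Averaging a monotone function over \<open>[s, 2 s]\<close> makes it continuous without losing
  monotonicity; this yields class K majorants of suprema that need not be continuous.\<close>

definition upper_avg :: "(real \<Rightarrow> real) \<Rightarrow> real \<Rightarrow> real" where
  "upper_avg M s = integral {1..2} (\<lambda>\<tau>. M (s * \<tau>))"

lemma upper_avg_integrable:
  fixes M :: "real \<Rightarrow> real"
  assumes "mono_on {0..} M" "0 \<le> s"
  shows "(\<lambda>\<tau>. M (s * \<tau>)) integrable_on {1..2::real}"
  by (rule integrable_on_mono_on)
    (use assms in \<open>auto intro!: mono_onI mono_onD[OF assms(1)] mult_left_mono\<close>)

lemma upper_avg_ge:
  assumes "mono_on {0..} M" "0 \<le> s"
  shows "M s \<le> upper_avg M s"
proof -
  have "M s \<le> M (s * \<tau>)" if "\<tau> \<in> {1..2}" for \<tau>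
    by (rule mono_onD[OF assms(1)]) (use that assms(2) in \<open>auto simp: mult_le_cancel_left1\<close>)
  then have "integral {1..2::real} (\<lambda>_. M s) \<le> upper_avg M s"
    unfolding upper_avg_def by (intro integral_le upper_avg_integrable[OF assms]) auto
  then show ?thesis by simp
qed

text \<open>The doubled argument is harmless, since this bound only carries limits over from
  \<open>M\<close>: at \<open>0\<close> for continuity, and as time tends to infinity for the KL
  estimate.\<close>

lemma upper_avg_le:
  assumes "mono_on {0..} M" "0 \<le> s"
  shows "upper_avg M s \<le> M (2 * s)"
proof -
  have "M (s * \<tau>) \<le> M (2 * s)" if "\<tau> \<in> {1..2}" for \<tau>
    by (rule mono_onD[OF assms(1)])
      (use that assms(2) in \<open>auto simp: mult.commute[of s] mult_right_mono\<close>)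
  then have "upper_avg M s \<le> integral {1..2::real} (\<lambda>_. M (2 * s))"
    unfolding upper_avg_def by (intro integral_le upper_avg_integrable[OF assms]) auto
  then show ?thesis by simp
qed

lemma upper_avg_mono:
  assumes "mono_on {0..} M" "0 \<le> r" "r \<le> s"
  shows "upper_avg M r \<le> upper_avg M s"
  unfolding upper_avg_def
  by (rule integral_le)
    (use assms in \<open>auto intro!: upper_avg_integrable mono_onD[OF assms(1)] mult_right_mono\<close>)

lemma upper_avg_mono_fun:
  assumes "mono_on {0..} M" "mono_on {0..} N" "\<And>r. 0 \<le> r \<Longrightarrow> M r \<le> N r" "0 \<le> s"
  shows "upper_avg M s \<le> upper_avg N s"
  unfolding upper_avg_def
  by (rule integral_le) (use assms in \<open>auto intro!: upper_avg_integrable\<close>)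

text \<open>The substitution \<open>x = s * \<tau>\<close> turns the average into a difference
  quotient of the indefinite integral of \<open>M\<close>, which is continuous even where
  \<open>M\<close> jumps.\<close>

lemma upper_avg_eq:
  assumes M: "mono_on {0..} M" and s: "0 < s"
  shows "upper_avg M s = (integral {0..2 * s} M - integral {0..s} M) / s"
proof -
  have int: "M integrable_on {0..2 * s}"
    by (rule integrable_on_mono_on) (use M in \<open>auto intro: monotone_on_subset\<close>)
  then have "M integrable_on {s..2 * s}"
    by (rule integrable_on_subinterval) (use s in auto)
  then have "(M has_integral integral {s..2 * s} M) (cbox s (2 * s))"
    by (simp add: integrable_integral)
  from has_integral_affinity'[OF this s, of 0]
  have "((\<lambda>x. M (s * x)) has_integral integral {s..2 * s} M / s) {s /\<^sub>R s..(2 * s) /\<^sub>R s}"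
    by (simp add: divide_inverse_commute)
  then have "((\<lambda>x. M (s * x)) has_integral integral {s..2 * s} M / s) {1..2}"
    using s by (simp add: field_simps)
  then have "upper_avg M s = integral {s..2 * s} M / s"
    unfolding upper_avg_def by (rule integral_unique)
  moreover have "integral {0..s} M + integral {s..2 * s} M = integral {0..2 * s} M"
    by (rule Henstock_Kurzweil_Integration.integral_combine) (use s int in auto)
  ultimately show ?thesis by (simp add: algebra_simps)
qed

text \<open>At \<open>s > 0\<close> continuity comes from \<open>upper_avg_eq\<close>. That formula
  divides by \<open>s\<close>, so at \<open>0\<close> the average is squeezed between
  \<open>0\<close> and \<open>M (2 * s)\<close> instead.\<close>

lemma upper_avg_continuous:
  assumes M: "mono_on {0..} M" and M0: "M 0 = 0" and lim: "(M \<longlongrightarrow> 0) (at_right 0)"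
  shows "continuous_on {0..} (upper_avg M)"
proof (clarsimp simp: continuous_on_eq_continuous_within)
  fix s :: real assume "0 \<le> s"
  show "continuous (at s within {0..}) (upper_avg M)"
  proof (cases "s = 0")
    case True
    have avg0: "upper_avg M 0 = 0" by (simp add: upper_avg_def M0)
    have "filterlim (\<lambda>s::real. 2 * s) (at_right 0) (at_right 0)"
      by (rule filterlim_times_pos[of _ 0]) (auto simp: filterlim_ident)
    then have lim2: "((\<lambda>s. M (2 * s)) \<longlongrightarrow> 0) (at_right 0)"
      by (rule filterlim_compose[OF lim])
    have "(upper_avg M \<longlongrightarrow> 0) (at_right 0)"
    proof (rule tendsto_sandwich[OF _ _ tendsto_const lim2])
      show "\<forall>\<^sub>F s in at_right 0. 0 \<le> upper_avg M s"
        using upper_avg_mono[OF M order_refl] avg0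
        by (auto simp: eventually_at_filter intro!: always_eventually)
      show "\<forall>\<^sub>F s in at_right 0. upper_avg M s \<le> M (2 * s)"
        using upper_avg_le[OF M] by (auto simp: eventually_at_filter intro!: always_eventually)
    qed
    then show ?thesis
      by (simp add: True continuous_within avg0 at_within_Ici_at_right)
  next
    case False
    with \<open>0 \<le> s\<close> have s: "0 < s" by simp
    define b where "b = 2 * (s + 1)"
    have "M integrable_on {0..b}"
      by (rule integrable_on_mono_on) (use M in \<open>auto intro: monotone_on_subset\<close>)
    then have G: "continuous_on {0..b} (\<lambda>x. integral {0..x} M)"
      by (rule indefinite_integral_continuous_1)
    have "continuous_on {0<..<s + 1} (\<lambda>s. (integral {0..2 * s} M - integral {0..s} M) / s)"
      by (intro continuous_intros continuous_on_compose2[OF G, of _ "\<lambda>s. 2 * s"]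
          continuous_on_subset[OF G]) (auto simp: b_def)
    then have "continuous_on {0<..<s + 1} (upper_avg M)"
      by (rule continuous_on_eq) (simp add: upper_avg_eq[OF M])
    then have "isCont (upper_avg M) s"
      using s by (simp add: continuous_on_eq_continuous_at)
    then show ?thesis by (rule continuous_at_imp_continuous_at_within)
  qed
qed

text \<open>The linear term supplies strictness: the average of \<open>M\<close> is constant in
  \<open>s\<close> wherever \<open>M\<close> is constant.\<close>

lemma upper_avg_class_K:
  assumes M: "mono_on {0..} M" and M0: "M 0 = 0" and lim: "(M \<longlongrightarrow> 0) (at_right 0)" and c: "c > 0"
  shows "class_K (\<lambda>s. upper_avg M s + c * s)"
  unfolding class_K_def
proof (intro conjI)
  show "continuous_on {0..} (\<lambda>s. upper_avg M s + c * s)"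
    by (intro continuous_intros upper_avg_continuous[OF M M0 lim])
  show "strict_mono_on {0..} (\<lambda>s. upper_avg M s + c * s)"
    using c by (auto intro!: strict_mono_onI add_le_less_mono upper_avg_mono[OF M])
  show "upper_avg M 0 + c * 0 = 0" by (simp add: upper_avg_def M0)
qed

lemma tendsto_at_right_0I:
  fixes M :: "real \<Rightarrow> real"
  assumes "\<And>\<epsilon>. \<epsilon> > 0 \<Longrightarrow> \<exists>\<delta>>0. \<forall>s. 0 < s \<and> s < \<delta> \<longrightarrow> \<bar>M s\<bar> \<le> \<epsilon>"
  shows "(M \<longlongrightarrow> 0) (at_right 0)"
proof (rule tendstoI)
  fix e :: real assume "e > 0"
  then obtain \<delta> where "\<delta> > 0" "\<forall>s. 0 < s \<and> s < \<delta> \<longrightarrow> \<bar>M s\<bar> \<le> e / 2"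
    using assms[of "e / 2"] by auto
  then show "\<forall>\<^sub>F s in at_right 0. dist (M s) 0 < e"
    using \<open>e > 0\<close> by (force simp: eventually_at_right_field dist_real_def intro!: exI[of _ \<delta>])
qed

subsection \<open>Size functions\<close>

lemma size_function_nonneg: "size_function X xbar w \<Longrightarrow> x \<in> X \<Longrightarrow> 0 \<le> w x"
  by (cases "x = xbar") (simp_all add: size_function_def less_imp_le)

text \<open>The part of the compact set \<open>w1 \<le> 1\<close> on which
  \<open>w2 \<ge> \<epsilon>\<close> is compact and misses \<open>xbar\<close>, so \<open>w1\<close>
  has a positive minimum there unless that part is empty.\<close>

lemma size_function_small:
  assumes w1: "size_function X xbar w1" and w2: "size_function X xbar w2" and "\<epsilon> > 0"
  obtains \<delta> where "\<delta> > 0" "\<And>x. x \<in> X \<Longrightarrow> w1 x < \<delta> \<Longrightarrow> w2 x < \<epsilon>"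
proof -
  define C where "C = {x \<in> X. w1 x \<le> 1} \<inter> w2 -` {\<epsilon>..}"
  have "compact {x \<in> X. w1 x \<le> 1}" using w1 by (simp add: size_function_def)
  moreover have "continuous_on {x \<in> X. w1 x \<le> 1} w2"
    using w2 by (auto simp: size_function_def intro: continuous_on_subset)
  then have "closedin (top_of_set {x \<in> X. w1 x \<le> 1}) C"
    unfolding C_def by (rule continuous_closedin_preimage) simp
  ultimately have C: "compact C" by (rule closedin_compact)
  show ?thesis
  proof (cases "C = {}")
    case True
    then show ?thesis by (intro that[of 1]) (auto simp: C_def)
  next
    case False
    have "continuous_on C w1"
      using w1 by (auto simp: size_function_def C_def intro: continuous_on_subset)
    then obtain z where z: "z \<in> C" "\<And>y. y \<in> C \<Longrightarrow> w1 z \<le> w1 y"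
      using continuous_attains_inf[OF C False] by blast
    have "z \<noteq> xbar" using z w2 \<open>\<epsilon> > 0\<close> by (auto simp: C_def size_function_def)
    then have "w1 z > 0" using z w1 by (auto simp: C_def size_function_def)
    then show ?thesis using z by (intro that[of "min 1 (w1 z)"]) (force simp: C_def)+
  qed
qed

text \<open>The supremum \<open>M r\<close> of \<open>w2\<close> over the sublevel set of
  \<open>w1\<close> is the best monotone bound, but it may jump, so it is replaced by its upper
  average. The added identity gives strict growth and unboundedness.\<close>

lemma size_function_comparison:
  assumes w1: "size_function X xbar w1" and w2: "size_function X xbar w2" and xbar: "xbar \<in> X"
  obtains \<kappa> where "class_K_inf \<kappa>" "\<And>x. x \<in> X \<Longrightarrow> w2 x \<le> \<kappa> (w1 x)"
proof -
  define S where "S r = {x \<in> X. w1 x \<le> r}" for r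
  define M where "M r = (SUP x\<in>S r. w2 x)" for r
  have xS: "xbar \<in> S r" if "0 \<le> r" for r
    using that w1 xbar by (auto simp: S_def size_function_def)
  have bdd: "bdd_above (w2 ` S r)" if "0 \<le> r" for r
  proof -
    have "compact (S r)" using that w1 by (simp add: S_def size_function_def)
    moreover have "continuous_on (S r) w2"
      using w2 by (auto simp: size_function_def S_def intro: continuous_on_subset)
    ultimately show ?thesis by (intro bounded_imp_bdd_above compact_imp_bounded compact_continuous_image)
  qed
  have mono: "mono_on {0..} M"
  proof (rule mono_onI)
    fix r s :: real assume "r \<in> {0..}" "s \<in> {0..}" "r \<le> s"
    then show "M r \<le> M s"
      unfolding M_def using xS[of r] bdd[of s] by (intro cSUP_subset_mono) (auto simp: S_def)
  qed
  have "S 0 = {xbar}" using xS[of 0] w1 by (force simp: S_def size_function_def)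
  then have M0: "M 0 = 0" using w2 by (simp add: M_def size_function_def)
  have nonneg: "M r \<ge> 0" if "0 \<le> r" for r using mono_onD[OF mono, of 0 r] that M0 by simp
  have "(M \<longlongrightarrow> 0) (at_right 0)"
  proof (rule tendsto_at_right_0I)
    fix \<epsilon> :: real assume "\<epsilon> > 0"
    from size_function_small[OF w1 w2 this] obtain \<delta>
      where \<delta>: "\<delta> > 0" "\<And>x. x \<in> X \<Longrightarrow> w1 x < \<delta> \<Longrightarrow> w2 x < \<epsilon>" by blast
    have "M s \<le> \<epsilon>" if "0 < s" "s < \<delta>" for s
      unfolding M_def using xS[of s] that \<delta>
      by (intro cSUP_least) (auto simp: S_def intro!: less_imp_le)
    then show "\<exists>\<delta>>0. \<forall>s. 0 < s \<and> s < \<delta> \<longrightarrow> \<bar>M s\<bar> \<le> \<epsilon>"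
      using \<delta>(1) nonneg by (intro exI[of _ \<delta>]) auto
  qed
  from upper_avg_class_K[OF mono M0 this, of 1]
  have K: "class_K (\<lambda>s. upper_avg M s + s)" by simp
  have "upper_avg M r + r > C" if "r = \<bar>C\<bar> + 1" for r C
    using upper_avg_ge[OF mono, of r] nonneg[of r] that by simp
  then have "class_K_inf (\<lambda>s. upper_avg M s + s)"
    unfolding class_K_inf_iff using K by (auto intro!: exI[of _ "\<bar>_\<bar> + 1"])
  moreover have "w2 x \<le> upper_avg M (w1 x) + w1 x" if "x \<in> X" for x
  proof -
    have w: "0 \<le> w1 x" using size_function_nonneg[OF w1 that] .
    have "w2 x \<le> M (w1 x)"
      unfolding M_def by (rule cSUP_upper) (use that bdd[OF w] in \<open>auto simp: S_def\<close>)
    then show ?thesis using upper_avg_ge[OF mono w] w by simp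
  qed
  ultimately show ?thesis by (rule that)
qed

text \<open>Merges separate positive bounds on the shells \<open>a \<le> W \<le> b\<close> into one
  continuous rate, even if \<open>D\<close> is discontinuous. The formula for
  \<open>\<alpha>\<close> is an infimal convolution with the absolute value.\<close>

lemma pos_def_lower_bound:
  fixes W D :: "'i \<Rightarrow> real"
  assumes nonneg: "\<And>i. i \<in> I \<Longrightarrow> 0 \<le> D i"
    and i0: "i0 \<in> I" "W i0 = 0" "D i0 = 0"
    and shell: "\<And>a b. 0 < a \<Longrightarrow> \<exists>c>0. \<forall>i\<in>I. a \<le> W i \<longrightarrow> W i \<le> b \<longrightarrow> c \<le> D i"
  obtains \<alpha> where "pos_def_fun \<alpha>" "\<And>i. i \<in> I \<Longrightarrow> \<alpha> (W i) \<le> D i"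
proof -
  \<comment> \<open>The largest 1-Lipschitz function with \<open>\<alpha> (W i) \<le> D i\<close> for all \<open>i\<close>.\<close>
  define \<alpha> where "\<alpha> v = (INF i\<in>I. D i + \<bar>v - W i\<bar>)" for v
  have bdd: "bdd_below ((\<lambda>i. D i + \<bar>v - W i\<bar>) ` I)" for v
    by (rule bdd_belowI[of _ 0]) (use nonneg in force)
  have upper: "\<alpha> v \<le> D i + \<bar>v - W i\<bar>" if "i \<in> I" for i v
    unfolding \<alpha>_def by (rule cINF_lower[OF bdd that])
  have lower: "c \<le> \<alpha> v" if "\<And>i. i \<in> I \<Longrightarrow> c \<le> D i + \<bar>v - W i\<bar>" for c v
    unfolding \<alpha>_def by (rule cINF_greatest) (use i0 that in auto)
  have one: "\<alpha> v - \<bar>v - w\<bar> \<le> \<alpha> w" for v w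
    by (rule lower) (use upper[of _ v] in force)
  have "1-lipschitz_on {0..} \<alpha>"
  proof (rule lipschitz_onI)
    show "dist (\<alpha> v) (\<alpha> w) \<le> 1 * dist v w" for v w
      using one[of v w] one[of w v] by (simp add: dist_real_def)
  qed simp
  then have cont: "continuous_on {0..} \<alpha>" by (rule lipschitz_on_continuous_on)
  have "\<alpha> 0 = 0" using upper[OF i0(1), of 0] lower[of 0 0] nonneg i0 by force
  moreover have "\<alpha> v > 0" if v: "v > 0" for v
  proof -
    obtain c where c: "c > 0" "\<And>i. i \<in> I \<Longrightarrow> v / 2 \<le> W i \<Longrightarrow> W i \<le> 2 * v \<Longrightarrow> c \<le> D i"
      using shell[of "v / 2" "2 * v"] v by auto
    \<comment> \<open>Indices with \<open>W i\<close> in \<open>[v / 2, 2 * v]\<close> contribute at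
      least \<open>c\<close>; all others lie at distance at least \<open>v / 2\<close> from
      \<open>v\<close>.\<close>
    have "min c (v / 2) \<le> \<alpha> v"
    proof (rule lower)
      fix i assume i: "i \<in> I"
      show "min c (v / 2) \<le> D i + \<bar>v - W i\<bar>"
        using c(2)[OF i] nonneg[OF i] v by linarith
    qed
    then show ?thesis using c v by linarith
  qed
  ultimately have "pos_def_fun \<alpha>" using cont by (simp add: pos_def_fun_def)
  moreover have "\<alpha> (W i) \<le> D i" if "i \<in> I" for i
    using upper[OF that, of "W i"] by simp
  ultimately show ?thesis by (rule that)
qed

lemma size_function_shift_continuous:
  assumes "size_function X xbar (\<lambda>x. V x - V xbar)"
  shows "continuous_on X V"
  using continuous_on_add[OF _ continuous_on_const[of X "V xbar"], of "\<lambda>x. V x - V xbar"] assms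
  by (simp add: size_function_def)

lemma size_function_shift_sublevel:
  assumes "size_function X xbar (\<lambda>x. V x - V xbar)" "x \<in> X"
  shows "compact {y \<in> X. V y \<le> V x}"
proof -
  have "compact {y \<in> X. V y - V xbar \<le> V x - V xbar}"
    using size_function_nonneg[OF assms] assms(1) unfolding size_function_def by blast
  then show ?thesis by simp
qed

subsection \<open>Input to state stability from a nonincreasing Lyapunov function\<close>

text \<open>The Lyapunov implication is silent where the input dominates; there \<open>decr\<close>
  steps in. One visit to a state with \<open>\<omega>\<close> below \<open>\<rho> U\<close>, where
  \<open>U\<close> is the supremum of the input norms, therefore bounds \<open>W\<close> for all
  later times.\<close>

lemma ISS_if_nonincreasing_Lyapunov:
  fixes f :: "'a::metric_space \<Rightarrow> 'u::real_normed_vector \<Rightarrow> 'a"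
  assumes xbar: "xbar \<in> X" and size: "size_function X xbar \<omega>"
    and lyap: "ISS_Lyapunov_function X xbar \<omega> f V"
    and inv: "\<And>x u. x \<in> X \<Longrightarrow> f x u \<in> X"
    and decr: "\<And>x u. x \<in> X \<Longrightarrow> V (f x u) \<le> V x"
  shows "ISS X \<omega> f"
proof -
  define W where "W x = V x - V xbar" for x
  obtain \<alpha> \<rho> where \<alpha>: "pos_def_fun \<alpha>" and \<rho>: "class_K_inf \<rho>"
    and gain: "\<And>x u. x \<in> X \<Longrightarrow> \<rho> (norm u) \<le> \<omega> x \<Longrightarrow> W (f x u) \<le> W x - \<alpha> (W x)"
    and W: "size_function X xbar W"
    using lyap unfolding ISS_Lyapunov_function_def W_def by fastforce
  obtain \<kappa>1 where \<kappa>1: "class_K_inf \<kappa>1" "\<And>x. x \<in> X \<Longrightarrow> W x \<le> \<kappa>1 (\<omega> x)"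
    using size_function_comparison[OF size W xbar] by blast
  obtain \<kappa>2 where \<kappa>2: "class_K_inf \<kappa>2" "\<And>x. x \<in> X \<Longrightarrow> \<omega> x \<le> \<kappa>2 (W x)"
    using size_function_comparison[OF W size xbar] by blast
  have K: "class_K \<kappa>1" "class_K \<kappa>2" "class_K \<rho>"
    using \<kappa>1 \<kappa>2 \<rho> by (auto simp: class_K_inf_def)
  note W_nonneg = size_function_nonneg[OF W] and \<omega>_nonneg = size_function_nonneg[OF size]
  have Wxbar: "W xbar = 0" by (simp add: W_def)
  have \<omega>xbar: "\<omega> xbar = 0" using size by (simp add: size_function_def)
  have \<alpha>0: "\<alpha> 0 = 0" using \<alpha> by (simp add: pos_def_fun_def)

  text \<open>\<open>S r t\<close> contains every state that can be reached from \<open>{\<omega> \<le> r}\<close> in \<open>t\<close> or more steps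
    that each lower \<open>W\<close> by at least \<open>\<alpha> (W x)\<close>: such a step costs at least \<open>c\<close>, and there
    is only \<open>\<kappa>1 r\<close> to spend.\<close>
  define S where "S r t = {y \<in> X. W y \<le> \<kappa>1 r \<and>
    (\<forall>c\<ge>0. (\<forall>v\<in>{W y..\<kappa>1 r}. c \<le> \<alpha> v) \<longrightarrow> t * c \<le> \<kappa>1 r)}" for r t :: real
  \<comment> \<open>The worst size that can survive until time \<open>t\<close>. It tends to
    \<open>0\<close> as \<open>r\<close> tends to \<open>0\<close> and as \<open>t\<close> tends to
    infinity, but may be discontinuous in \<open>r\<close>, hence the averaging in
    \<open>\<beta>\<close>.\<close>
  define T where "T t r = (SUP y\<in>S r t. \<omega> y)" for t r
  \<comment> \<open>As \<open>\<alpha> 0 = 0\<close>, only \<open>c = 0\<close> is possible at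
    \<open>xbar\<close>; so the supremum \<open>T\<close> is over a nonempty set.\<close>
  have xS: "xbar \<in> S r t" if "0 \<le> r" for r t
  proof -
    have "0 \<in> {W xbar..\<kappa>1 r}" using class_K_nonneg[OF K(1) that] by (simp add: Wxbar)
    then have "t * c \<le> \<kappa>1 r" if "0 \<le> c" "\<forall>v\<in>{W xbar..\<kappa>1 r}. c \<le> \<alpha> v" for c
      using that \<alpha>0 by (metis antisym atLeastAtMost_iff mult_zero_right)
    then show ?thesis using class_K_nonneg[OF K(1) that] xbar by (simp add: S_def Wxbar)
  qed
  have S_bound: "\<omega> y \<le> \<kappa>2 (\<kappa>1 r)" if "y \<in> S r t" for y r t
  proof -
    have y: "y \<in> X" "W y \<le> \<kappa>1 r" using that by (auto simp: S_def)
    then show ?thesis using \<kappa>2(2)[OF y(1)] class_K_mono[OF K(2) W_nonneg[OF y(1)] y(2)] by simp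
  qed
  then have bdd: "bdd_above (\<omega> ` S r t)" for r t
    by (intro bdd_aboveI[of _ "\<kappa>2 (\<kappa>1 r)"]) auto
  have T_ge: "\<omega> y \<le> T t r" if "y \<in> S r t" for y r t
    unfolding T_def by (rule cSUP_upper[OF that bdd])
  have T_le: "T t r \<le> C" if "0 \<le> r" "\<And>y. y \<in> S r t \<Longrightarrow> \<omega> y \<le> C" for r t C
    unfolding T_def by (rule cSUP_least) (use xS[OF that(1)] that(2) in auto)
  have T_nonneg: "0 \<le> T t r" if "0 \<le> r" for t r
    using T_ge[OF xS[OF that]] \<omega>xbar by metis
  have T_mono: "mono_on {0..} (T t)" if "0 \<le> t" for t
  proof (rule mono_onI)
    fix r s :: real assume r: "r \<in> {0..}" "s \<in> {0..}" "r \<le> s"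
    then have le: "\<kappa>1 r \<le> \<kappa>1 s" by (simp add: class_K_mono[OF K(1)])
    \<comment> \<open>A larger \<open>r\<close> both restricts the admissible \<open>c\<close>, as
      the interval grows, and raises the budget.\<close>
    then have "S r t \<subseteq> S s t" by (fastforce simp: S_def)
    then show "T t r \<le> T t s" using r by (intro T_le T_ge) auto
  qed
  have T_antimono: "T t r \<le> T s r" if "0 \<le> s" "s \<le> t" "0 \<le> r" for s t r
  proof -
    have "s * c \<le> \<kappa>1 r" if "0 \<le> c" "t * c \<le> \<kappa>1 r" for c
      using mult_right_mono[OF \<open>s \<le> t\<close> that(1)] that(2) by linarith
    then have "S r t \<subseteq> S r s" by (auto simp: S_def)
    then show ?thesis using that by (intro T_le T_ge) auto
  qed
  have T0: "T t 0 = 0" for t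
  proof (rule antisym)
    show "T t 0 \<le> 0" using K by (intro T_le) (auto dest!: S_bound simp: class_K_def)
  qed (rule T_nonneg, simp)
  have T_right: "(T t \<longlongrightarrow> 0) (at_right 0)" for t
  proof -
    have "class_K (\<lambda>r. \<kappa>2 (\<kappa>1 r))"
      using class_K_inf_compose[OF \<kappa>2(1) \<kappa>1(1)] by (simp add: class_K_inf_def)
    then have lim: "((\<lambda>r. \<kappa>2 (\<kappa>1 r)) \<longlongrightarrow> 0) (at_right 0)"
      unfolding class_K_def continuous_on_def at_within_Ici_at_right[symmetric]
      by (metis atLeast_iff order_refl)
    have "\<forall>\<^sub>F r in at_right 0. 0 \<le> T t r" "\<forall>\<^sub>F r in at_right 0. T t r \<le> \<kappa>2 (\<kappa>1 r)"
      by (auto simp: eventually_at_filter intro!: always_eventually T_nonneg T_le S_bound)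
    then show ?thesis by (rule tendsto_sandwich[OF _ _ tendsto_const lim])
  qed
  have T_lim: "((\<lambda>t. T t r) \<longlongrightarrow> 0) at_top" if r: "0 \<le> r" for r
  proof (rule tendstoI)
    fix e :: real assume e: "e > 0"
    obtain \<delta> where \<delta>: "\<delta> > 0" "\<And>x. x \<in> X \<Longrightarrow> W x < \<delta> \<Longrightarrow> \<omega> x < e / 2"
      using size_function_small[OF W size, of "e / 2"] e by auto
    \<comment> \<open>The maximum keeps \<open>{\<delta>..b}\<close> nonempty. While
      \<open>W y \<ge> \<delta>\<close>, the minimum \<open>\<alpha> v0\<close> over this interval
      is a cost per step, so the budget \<open>\<kappa>1 r\<close> cannot cover times beyond
      \<open>\<kappa>1 r / \<alpha> v0\<close>.\<close>
    define b where "b = max \<delta> (\<kappa>1 r)"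
    have "continuous_on {\<delta>..b} \<alpha>"
      using \<alpha> \<delta> by (auto simp: pos_def_fun_def intro: continuous_on_subset)
    then obtain v0 where v0: "v0 \<in> {\<delta>..b}" "\<And>v. v \<in> {\<delta>..b} \<Longrightarrow> \<alpha> v0 \<le> \<alpha> v"
      using continuous_attains_inf[of "{\<delta>..b}" \<alpha>] by (auto simp: b_def)
    have pos: "\<alpha> v0 > 0" using \<alpha> \<delta>(1) v0(1) by (auto simp: pos_def_fun_def)
    have "T t r \<le> e / 2" if t: "t > \<kappa>1 r / \<alpha> v0" for t
    proof (rule T_le[OF r])
      fix y assume y: "y \<in> S r t"
      have "W y < \<delta>"
      proof (rule ccontr)
        assume "\<not> W y < \<delta>"
        then have "\<forall>v\<in>{W y..\<kappa>1 r}. \<alpha> v0 \<le> \<alpha> v" using v0(2) by (auto simp: b_def)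
        then have "t * \<alpha> v0 \<le> \<kappa>1 r" using y pos by (auto simp: S_def)
        then show False using t pos by (simp add: field_simps)
      qed
      then show "\<omega> y \<le> e / 2" using \<delta>(2) y by (force simp: S_def)
    qed
    then have "\<forall>\<^sub>F t in at_top. T t r \<le> e / 2"
      using eventually_gt_at_top[of "\<kappa>1 r / \<alpha> v0"] by (rule eventually_mono[rotated])
    then show "\<forall>\<^sub>F t in at_top. dist (T t r) 0 < e"
      by (rule eventually_mono) (use T_nonneg[OF r] e in \<open>auto simp: dist_real_def\<close>)
  qed

  \<comment> \<open>The weight \<open>1 / (1 + t)\<close> keeps \<open>\<beta>\<close> strictly
    increasing in \<open>r\<close> at each \<open>t\<close> and still lets it vanish as
    \<open>t\<close> grows. In \<open>\<gamma>\<close>, the bound \<open>\<rho> r\<close> on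
    \<open>\<omega>\<close> is translated into one on \<open>W\<close> and back.\<close>
  define \<beta> where "\<beta> r t = upper_avg (T t) r + 1 / (1 + t) * r" for r t
  define \<gamma> where "\<gamma> r = \<kappa>2 (\<kappa>1 (\<rho> r))" for r
  have "class_KL \<beta>"
    unfolding class_KL_def
  proof (intro conjI allI impI)
    fix t :: real assume t: "0 \<le> t"
    show "class_K (\<lambda>r. \<beta> r t)"
      unfolding \<beta>_def by (rule upper_avg_class_K[OF T_mono[OF t] T0 T_right]) (use t in simp)
  next
    fix r :: real assume r: "0 \<le> r"
    show "antimono_on {0..} (\<beta> r)"
    proof (rule monotone_onI)
      fix s t :: real assume st: "s \<in> {0..}" "t \<in> {0..}" "s \<le> t"
      have "upper_avg (T t) r \<le> upper_avg (T s) r"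
        using st r by (intro upper_avg_mono_fun T_mono T_antimono) auto
      moreover have "1 / (1 + t) * r \<le> 1 / (1 + s) * r"
        using st r by (intro mult_right_mono divide_left_mono) auto
      ultimately show "\<beta> r t \<le> \<beta> r s" unfolding \<beta>_def by (rule add_mono)
    qed
    have "((\<lambda>t. upper_avg (T t) r) \<longlongrightarrow> 0) at_top"
    proof (rule tendsto_sandwich[OF _ _ tendsto_const T_lim[of "2 * r"]])
      show "\<forall>\<^sub>F t in at_top. 0 \<le> upper_avg (T t) r"
        using eventually_ge_at_top[of 0]
        by (rule eventually_mono) (meson order_trans T_nonneg[OF r] upper_avg_ge[OF T_mono r])
      show "\<forall>\<^sub>F t in at_top. upper_avg (T t) r \<le> T t (2 * r)"
        using eventually_ge_at_top[of 0] by (rule eventually_mono) (rule upper_avg_le[OF T_mono r])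
    qed (use r in simp)
    moreover have "((\<lambda>t. 1 / (1 + t) * r) \<longlongrightarrow> 0) at_top"
      by (intro tendsto_mult_left_zero tendsto_divide_0[OF tendsto_const]
          filterlim_at_top_imp_at_infinity filterlim_tendsto_add_at_top[OF tendsto_const filterlim_ident])
    ultimately show "(\<beta> r \<longlongrightarrow> 0) at_top"
      unfolding \<beta>_def using tendsto_add by fastforce
  qed
  moreover have "class_K_inf \<gamma>"
    unfolding \<gamma>_def by (intro class_K_inf_compose[OF \<kappa>2(1)] class_K_inf_compose[OF \<kappa>1(1)] \<rho>)
  moreover have "\<omega> (trajectory f x u t) \<le> \<beta> (\<omega> x) (real t) + \<gamma> (SUP s. norm (u s))"
    if u: "bounded (range u)" and x: "x \<in> X" for u :: "nat \<Rightarrow> 'u" and x t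
  proof -
    define U where "U = (SUP s. norm (u s))"
    define z where "z = trajectory f x u"
    have "bdd_above (range (\<lambda>s. norm (u s)))"
      using u by (simp add: bdd_above_norm[symmetric] image_image)
    then have U: "norm (u s) \<le> U" for s unfolding U_def by (intro cSUP_upper) auto
    then have U0: "0 \<le> U" using norm_ge_zero order_trans by blast
    have zX: "z s \<in> X" for s unfolding z_def by (induction s) (auto simp: x inv)
    have zdecr: "W (z (Suc s)) \<le> W (z s)" for s
      using decr[OF zX[of s]] by (simp add: z_def W_def)
    then have zanti: "W (z t) \<le> W (z s)" if "s \<le> t" for s t
      using that by (rule lift_Suc_antimono_le)
    have wx: "0 \<le> \<omega> x" using \<omega>_nonneg[OF x] .
    have \<beta>_ge: "T (real t) (\<omega> x) \<le> \<beta> (\<omega> x) (real t)"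
      unfolding \<beta>_def using upper_avg_ge[OF T_mono wx, of "real t"] wx by (simp add: add_increasing2)
    have \<gamma>_nonneg: "0 \<le> \<gamma> U"
      unfolding \<gamma>_def using U0 K class_K_nonneg by metis
    show ?thesis
    proof (cases "\<exists>s\<le>t. \<omega> (z s) < \<rho> U")
      case True
      then obtain s where s: "s \<le> t" "\<omega> (z s) < \<rho> U" by blast
      have "W (z t) \<le> \<kappa>1 (\<omega> (z s))" using zanti[OF s(1)] \<kappa>1(2)[OF zX[of s]] by simp
      also have "\<dots> \<le> \<kappa>1 (\<rho> U)" using s \<omega>_nonneg[OF zX[of s]] by (intro class_K_mono[OF K(1)]) auto
      finally have "\<omega> (z t) \<le> \<gamma> U"
        unfolding \<gamma>_def
        using \<kappa>2(2)[OF zX[of t]] class_K_mono[OF K(2) W_nonneg[OF zX[of t]]] order_trans by blast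
      then show ?thesis using \<beta>_ge T_nonneg[OF wx, of "real t"] by (simp add: U_def z_def)
    next
      case False
      have step: "W (z (Suc s)) \<le> W (z s) - \<alpha> (W (z s))" if "s \<le> t" for s
      proof -
        have "\<rho> (norm (u s)) \<le> \<rho> U" by (intro class_K_mono[OF K(3)] U) simp
        also have "\<dots> \<le> \<omega> (z s)" using False that by auto
        finally show ?thesis using gain[OF zX[of s]] by (simp add: z_def)
      qed
      have W0: "W (z 0) \<le> \<kappa>1 (\<omega> x)" using \<kappa>1(2)[OF x] by (simp add: z_def)
      \<comment> \<open>\<open>W\<close> is nonincreasing along \<open>z\<close>, so all values up
        to time \<open>t\<close> lie in this interval and each step costs at least \<open>c\<close>;
        the costs telescope.\<close>
      have "real t * c \<le> \<kappa>1 (\<omega> x)" if c: "\<forall>v\<in>{W (z t)..\<kappa>1 (\<omega> x)}. c \<le> \<alpha> v" for c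
      proof -
        have "real s * c \<le> W (z 0) - W (z s)" if "s \<le> t" for s
          using that
        proof (induction s)
          case (Suc s)
          have "c \<le> \<alpha> (W (z s))"
            using c zanti[of s t] zanti[of 0 s] W0 Suc.prems by auto
          then show ?case using Suc step[of s] by (simp add: algebra_simps)
        qed simp
        from this[of t] show ?thesis using W0 W_nonneg[OF zX[of t]] by simp
      qed
      then have "z t \<in> S (\<omega> x) (real t)"
        using zX[of t] zanti[of 0 t] W0 by (auto simp: S_def)
      then have "\<omega> (z t) \<le> T (real t) (\<omega> x)" by (rule T_ge)
      then show ?thesis using \<beta>_ge \<gamma>_nonneg by (simp add: U_def z_def)
    qed
  qed
  ultimately show ?thesis unfolding ISS_def by blast
qed

subsection \<open>Decrease along the perturbed descent step\<close>

lemma DERIV_along_ray: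
  fixes V :: "'a::euclidean_space \<Rightarrow> real"
  assumes "V differentiable (at (x - \<mu> *\<^sub>R d))"
  shows "((\<lambda>\<mu>. V (x - \<mu> *\<^sub>R d)) has_real_derivative - (d \<bullet> gradient V (x - \<mu> *\<^sub>R d))) (at \<mu>)"
proof -
  have "((\<lambda>\<mu>. x - \<mu> *\<^sub>R d) has_derivative (\<lambda>h. - (h *\<^sub>R d))) (at \<mu>)"
    by (auto intro!: derivative_eq_intros)
  from has_derivative_compose[OF this GDERIV_gradient[OF assms, unfolded gderiv_def]]
  have "((\<lambda>\<mu>. V (x - \<mu> *\<^sub>R d)) has_derivative
      (\<lambda>h. - (h *\<^sub>R d) \<bullet> gradient V (x - \<mu> *\<^sub>R d))) (at \<mu>)" .
  then show ?thesis
    unfolding has_field_derivative_def by (rule has_derivative_eq_rhs) (auto simp: fun_eq_iff)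
qed

text \<open>Minimality lets any convenient admissible length stand in for the step length, which is
  not known explicitly.\<close>

lemma descent_step_le_step:
  fixes X :: "'a::euclidean_space set"
  assumes "size_function X xbar (\<lambda>x. V x - V xbar)" "x \<in> X" "l \<in> step_set X V x q"
  shows "V (descent_step X V x q) \<le> V (x - l *\<^sub>R (gradient V x + q))"
proof (cases "gradient V x + q = 0")
  case False
  show ?thesis
    using step_length_props(1)[OF size_function_shift_continuous[OF assms(1)]
        size_function_shift_sublevel[OF assms(1,2)] False assms(2)] assms(3) False
    by (auto simp: descent_step_def is_arg_min_def not_less)
qed (simp add: descent_step_def)

lemma descent_step_le:
  fixes X :: "'a::euclidean_space set"
  assumes "size_function X xbar (\<lambda>x. V x - V xbar)" "x \<in> X"
  shows "V (descent_step X V x q) \<le> V x"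
  using descent_step_le_step[OF assms zero_in_step_set[OF assms(2)]] by simp

text \<open>Along the ray the slope of \<open>V\<close> stays below \<open>- |g|^2 / 4\<close> up to
  length \<open>1 / (9 * L)\<close>, and the product of the two is the claimed decrease. As the
  Lipschitz bound holds only on the sublevel set, the ray must first be shown to stay in it that
  long.\<close>

lemma descent_step_decrease:
  fixes X :: "'a::euclidean_space set"
  assumes X: "open X" and diff: "V differentiable_on X" and x: "x \<in> X"
    and size: "size_function X xbar (\<lambda>x. V x - V xbar)"
    and L: "L > 0" and lip: "L-lipschitz_on {y \<in> X. V y \<le> V x} (gradient V)"
    and q: "norm q \<le> norm (gradient V x) / 2"
  shows "V (descent_step X V x q) \<le> V x - (norm (gradient V x))\<^sup>2 / (36 * L)"
proof (cases "gradient V x = 0")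
  case True
  then show ?thesis using descent_step_le[OF size x] by simp
next
  case False
  define g where "g = gradient V x"
  define d where "d = g + q"
  define \<phi> where "\<phi> \<mu> = V (x - \<mu> *\<^sub>R d)" for \<mu>
  \<comment> \<open>Up to this length the change of the gradient costs at most
    \<open>|d|^2 / 9 \<le> |g|^2 / 4\<close>, half of the initial descent rate
    \<open>|g|^2 / 2\<close>.\<close>
  define l where "l = 1 / (9 * L)"
  have g: "norm g > 0" using False by (simp add: g_def)
  have "\<bar>q \<bullet> g\<bar> \<le> norm q * norm g" by (rule Cauchy_Schwarz_ineq2)
  also have "\<dots> \<le> norm g / 2 * norm g" using q by (intro mult_right_mono) (auto simp: g_def)
  finally have "- (q \<bullet> g) \<le> (norm g)\<^sup>2 / 2" by (simp add: power2_eq_square)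
  then have dg: "(norm g)\<^sup>2 / 2 \<le> d \<bullet> g" by (simp add: d_def inner_add_left dot_square_norm)
  have d0: "d \<noteq> 0" using dg g by auto
  have "norm d \<le> 3 / 2 * norm g" using norm_triangle_ineq[of g q] q by (simp add: d_def g_def)
  then have "(norm d)\<^sup>2 \<le> (3 / 2 * norm g)\<^sup>2" by (rule power_mono) simp
  then have nd: "(norm d)\<^sup>2 \<le> 9 / 4 * (norm g)\<^sup>2" by (simp add: power_mult_distrib power2_eq_square)
  have step_iff: "l \<in> step_set X V x q \<longleftrightarrow> l \<ge> 0 \<and> (\<forall>\<mu>\<in>{0..l}. x - \<mu> *\<^sub>R d \<in> X \<and> \<phi> \<mu> \<le> V x)" for l
    by (simp add: step_set_def d_def g_def \<phi>_def)
  have \<phi>': "(\<phi> has_real_derivative - (d \<bullet> gradient V (x - \<mu> *\<^sub>R d))) (at \<mu>)"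
    if "x - \<mu> *\<^sub>R d \<in> X" for \<mu>
  proof -
    have "V differentiable (at (x - \<mu> *\<^sub>R d))"
      using diff X that by (metis at_within_open differentiable_on_def)
    then show ?thesis unfolding \<phi>_def by (rule DERIV_along_ray)
  qed
  have slope: "- (d \<bullet> gradient V (x - \<mu> *\<^sub>R d)) \<le> - ((norm g)\<^sup>2 / 4)"
    if \<mu>: "0 \<le> \<mu>" "\<mu> \<le> l" and y: "x - \<mu> *\<^sub>R d \<in> X" "\<phi> \<mu> \<le> V x" for \<mu>
  proof -
    define e where "e = g - gradient V (x - \<mu> *\<^sub>R d)"
    have "norm e \<le> L * norm (\<mu> *\<^sub>R d)"
      using lipschitz_onD[OF lip, of x "x - \<mu> *\<^sub>R d"] x y
      by (simp add: e_def g_def dist_norm \<phi>_def)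
    also have "\<dots> = (L * \<mu>) * norm d" using \<mu> by simp
    also have "\<dots> \<le> 1 / 9 * norm d"
      using \<mu> L by (intro mult_right_mono) (auto simp: l_def field_simps)
    finally have "norm d * norm e \<le> norm d * (1 / 9 * norm d)" by (rule mult_left_mono) simp
    then have "norm d * norm e \<le> (norm g)\<^sup>2 / 4" using nd by (simp add: power2_eq_square)
    moreover have "d \<bullet> e \<le> norm d * norm e" by (rule norm_cauchy_schwarz)
    moreover have "d \<bullet> e = d \<bullet> g - d \<bullet> gradient V (x - \<mu> *\<^sub>R d)"
      by (simp add: e_def inner_diff_right)
    ultimately show ?thesis using dg by linarith
  qed
  \<comment> \<open>Continuation argument: if the largest admissible length \<open>l0\<close> were
    below \<open>l\<close>, the negative slope at \<open>l0\<close> and the openness of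
    \<open>X\<close> would admit slightly longer steps.\<close>
  have l_step: "l \<in> step_set X V x q"
  proof (rule ccontr)
    assume "l \<notin> step_set X V x q"
    have "compact (step_set X V x q)"
      by (rule step_set_compact[OF size_function_shift_continuous[OF size] size_function_shift_sublevel[OF size x]])
        (use d0 in \<open>simp add: d_def g_def\<close>)
    then obtain l0 where l0: "l0 \<in> step_set X V x q" "\<And>k. k \<in> step_set X V x q \<Longrightarrow> k \<le> l0"
      using compact_attains_sup zero_in_step_set[OF x] by (metis emptyE)
    have "0 \<le> l" using L by (simp add: l_def)
    then have "l0 < l" using \<open>l \<notin> _\<close> l0(1) by (force simp: step_iff)
    have y: "0 \<le> l0" "x - l0 *\<^sub>R d \<in> X" "\<phi> l0 \<le> V x" using l0(1) by (auto simp: step_iff)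
    have "- (d \<bullet> gradient V (x - l0 *\<^sub>R d)) \<le> - ((norm g)\<^sup>2 / 4)"
      using \<open>l0 < l\<close> by (intro slope y) simp
    also have "\<dots> < 0" using g by simp
    finally have "- (d \<bullet> gradient V (x - l0 *\<^sub>R d)) < 0" .
    from DERIV_neg_dec_right[OF \<phi>'[OF y(2)] this] obtain \<epsilon>1
      where \<epsilon>1: "\<epsilon>1 > 0" "\<And>h. 0 < h \<Longrightarrow> h < \<epsilon>1 \<Longrightarrow> \<phi> (l0 + h) < \<phi> l0" by blast
    have "open ((\<lambda>\<mu>. x - \<mu> *\<^sub>R d) -` X)"
      by (rule open_vimage[OF X]) (intro continuous_intros)
    then obtain \<epsilon>2 where \<epsilon>2: "\<epsilon>2 > 0" "\<And>\<mu>. dist \<mu> l0 < \<epsilon>2 \<Longrightarrow> x - \<mu> *\<^sub>R d \<in> X"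
      unfolding open_dist using y(2) by blast
    define h where "h = min \<epsilon>1 \<epsilon>2 / 2"
    have h: "0 < h" "h < \<epsilon>1" "h < \<epsilon>2" using \<epsilon>1(1) \<epsilon>2(1) by (auto simp: h_def)
    have "x - \<mu> *\<^sub>R d \<in> X \<and> \<phi> \<mu> \<le> V x" if "\<mu> \<in> {0..l0 + h}" for \<mu>
    proof (cases "\<mu> \<le> l0")
      case True
      then show ?thesis using l0(1) that by (auto simp: step_iff)
    next
      case False
      then show ?thesis
        using \<epsilon>1(2)[of "\<mu> - l0"] \<epsilon>2(2)[of \<mu>] h that y(3) by (auto simp: dist_real_def)
    qed
    then have "l0 + h \<in> step_set X V x q" using h y(1) by (simp add: step_iff)
    then show False using l0(2) h by fastforce
  qed
  have lpos: "0 < l" using L by (simp add: l_def)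
  have in_step: "x - \<mu> *\<^sub>R d \<in> X" "\<phi> \<mu> \<le> V x" if "0 \<le> \<mu>" "\<mu> \<le> l" for \<mu>
    using l_step that by (auto simp: step_iff)
  obtain \<xi> where \<xi>: "0 < \<xi>" "\<xi> < l" "\<phi> l - \<phi> 0 = (l - 0) * - (d \<bullet> gradient V (x - \<xi> *\<^sub>R d))"
    using MVT2[OF lpos \<phi>'] in_step by blast
  have "\<phi> l - \<phi> 0 \<le> l * - ((norm g)\<^sup>2 / 4)"
    using \<xi> lpos slope[of \<xi>] in_step[of \<xi>] by (simp del: mult_minus_right)
  then have "\<phi> l \<le> V x - (norm g)\<^sup>2 / (36 * L)"
    by (simp add: \<phi>_def l_def)
  moreover have "V (descent_step X V x q) \<le> \<phi> l"
    using descent_step_le_step[OF size x l_step] by (simp add: \<phi>_def d_def g_def)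
  ultimately show ?thesis by (simp add: g_def)
qed

text \<open>The shell is compact and excludes \<open>xbar\<close>, so the gradient is bounded away
  from \<open>0\<close> on it. The Lipschitz constant is taken on the whole sublevel set
  \<open>K\<close>, because a descending ray may leave the shell downwards.\<close>

lemma descent_step_decrease_on_shell:
  fixes X :: "'a::euclidean_space set"
  assumes X: "open X" and diff: "V differentiable_on X"
    and lip: "locally_lipschitz_on X (gradient V)"
    and size: "size_function X xbar (\<lambda>x. V x - V xbar)"
    and grad: "size_function X xbar (\<lambda>x. norm (gradient V x))" and a: "0 < a"
  shows "\<exists>c>0. \<forall>x\<in>X. \<forall>q. a \<le> V x - V xbar \<longrightarrow> V x - V xbar \<le> b \<longrightarrow>
    norm q \<le> norm (gradient V x) / 2 \<longrightarrow> c \<le> V x - V (descent_step X V x q)"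
proof (cases "{x \<in> X. a \<le> V x - V xbar \<and> V x - V xbar \<le> b} = {}")
  case True
  then show ?thesis by (intro exI[of _ 1]) auto
next
  case False
  define K where "K = {x \<in> X. V x - V xbar \<le> b}"
  define S where "S = K \<inter> (\<lambda>x. V x - V xbar) -` {a..}"
  have S_eq: "S = {x \<in> X. a \<le> V x - V xbar \<and> V x - V xbar \<le> b}" by (auto simp: S_def K_def)
  have "b \<ge> 0" using False a by auto
  then have K: "compact K" using size by (simp add: size_function_def K_def)
  have "continuous_on K (\<lambda>x. V x - V xbar)"
    using size by (auto simp: size_function_def K_def intro: continuous_on_subset)
  then have "closedin (top_of_set K) S"
    unfolding S_def by (rule continuous_closedin_preimage) simp
  with K have "compact S" by (rule closedin_compact)
  moreover have "continuous_on S (\<lambda>x. norm (gradient V x))"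
    using grad by (auto simp: size_function_def S_eq intro: continuous_on_subset)
  ultimately obtain z where z: "z \<in> S" "\<And>y. y \<in> S \<Longrightarrow> norm (gradient V z) \<le> norm (gradient V y)"
    using continuous_attains_inf[of S "\<lambda>x. norm (gradient V x)"] False unfolding S_eq by blast
  have "z \<noteq> xbar" using z(1) a by (auto simp: S_eq)
  then have gz: "norm (gradient V z) > 0" using grad z(1) unfolding size_function_def S_eq by blast
  \<comment> \<open>The dummy time set \<open>UNIV\<close> is shrunk to a compact one, so that
    compactness turns local Lipschitz bounds into one constant on \<open>K\<close>.\<close>
  have "local_lipschitz {0::real} K (\<lambda>_. gradient V)"
    using lip unfolding locally_lipschitz_on_def
    by (rule local_lipschitz_subset) (auto simp: K_def)
  then obtain L0 where L0: "L0-lipschitz_on K (gradient V)"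
    by (rule local_lipschitz_compact_implies_lipschitz[OF _ K]) auto
  \<comment> \<open>\<open>L0\<close> may be \<open>0\<close>, and \<open>L\<close> is divided
    by.\<close>
  define L where "L = L0 + 1"
  have L: "L > 0" "L-lipschitz_on K (gradient V)"
    using L0 lipschitz_on_nonneg[OF L0] by (auto simp: L_def intro: lipschitz_on_le)
  have "(norm (gradient V z))\<^sup>2 / (36 * L) \<le> V x - V (descent_step X V x q)"
    if x: "x \<in> X" "a \<le> V x - V xbar" "V x - V xbar \<le> b" and q: "norm q \<le> norm (gradient V x) / 2"
    for x q
  proof -
    have "L-lipschitz_on {y \<in> X. V y \<le> V x} (gradient V)"
      using L(2) by (rule lipschitz_on_subset) (use x in \<open>auto simp: K_def\<close>)
    from descent_step_decrease[OF X diff x(1) size L(1) this q]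
    have "(norm (gradient V x))\<^sup>2 / (36 * L) \<le> V x - V (descent_step X V x q)" by simp
    moreover have "(norm (gradient V z))\<^sup>2 / (36 * L) \<le> (norm (gradient V x))\<^sup>2 / (36 * L)"
      using z(2)[of x] x L(1) by (intro divide_right_mono power_mono) (auto simp: S_eq)
    ultimately show ?thesis by linarith
  qed
  then show ?thesis using gz L(1) by (intro exI[of _ "(norm (gradient V z))\<^sup>2 / (36 * L)"]) auto
qed

section \<open>From bounds on the perturbation to bounds on the input\<close>

text \<open>The norm on matrices is the Frobenius norm; it bounds every entry and thereby the
  operator norm. The \<open>+ 1\<close> makes \<open>b\<close> positive, so that
  \<open>\<rho>\<close> below is of class K-infinity.\<close>

lemma bounded_matrix_family_norm_le:
  fixes B :: "'a \<Rightarrow> real^'m^'n"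
  assumes "bounded (B ` X)"
  obtains b where "b > 0" "\<And>x u. x \<in> X \<Longrightarrow> norm (B x *v u) \<le> b * norm u"
proof -
  obtain b0 where b0: "\<And>x. x \<in> X \<Longrightarrow> norm (B x) \<le> b0" using assms by (auto simp: bounded_iff)
  define b where "b = real CARD('n) * real CARD('m) * (\<bar>b0\<bar> + 1)"
  have "norm (B x *v u) \<le> b * norm u" if "x \<in> X" for x u
  proof -
    have "\<bar>B x $ i $ j\<bar> \<le> \<bar>b0\<bar> + 1" for i j
      using component_le_norm_cart[of "B x $ i" j] Finite_Cartesian_Product.norm_nth_le[of "B x" i] b0[OF that] by linarith
    then have "onorm ((*v) (B x)) \<le> b" unfolding b_def by (rule onorm_le_matrix_component)
    moreover have "norm (B x *v u) \<le> onorm ((*v) (B x)) * norm u"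
      by (rule onorm) (simp add: matrix_vector_mul_bounded_linear)
    ultimately show ?thesis by (meson mult_right_mono norm_ge_zero order_trans)
  qed
  moreover have "b > 0" by (simp add: b_def)
  ultimately show ?thesis by (rule that[rotated])
qed

theorem theorem4:
  fixes X :: "(real ^ 'n) set" and xbar :: "real ^ 'n"
    and \<omega> V :: "real ^ 'n \<Rightarrow> real"
    and B :: "real ^ 'n \<Rightarrow> real ^ 'm ^ 'n"
    and f :: "real ^ 'n \<Rightarrow> real ^ 'm \<Rightarrow> real ^ 'n"
  assumes "open X" and "xbar \<in> X"
    and "size_function X xbar \<omega>"
    and "continuously_differentiable_on V X"
    and "size_function X xbar (\<lambda>x. V x - V xbar)"
    and "locally_lipschitz_on X (gradient V)"
    and "size_function X xbar (\<lambda>x. norm (gradient V x))"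
    and "bounded (B ` X)"
    and "\<And>x u. x \<in> X \<Longrightarrow> f x u = descent_step X V x (B x *v u)"
  shows "ISS X \<omega> f \<and> ISS_Lyapunov_function X xbar \<omega> f V"
proof -
  note xbar = assms(2) and size = assms(5) and grad = assms(7) and f = assms(9)
  have diff: "V differentiable_on X" using assms(4) by (simp add: continuously_differentiable_on_def)
  \<comment> \<open>Indexing by pairs makes the rate \<open>\<alpha>\<close> uniform over all small
    perturbations. The zero index is \<open>(xbar, 0)\<close>, where the gradient vanishes and the
    step stays put.\<close>
  define I where "I = {(x, q::real^'n). x \<in> X \<and> norm q \<le> norm (gradient V x) / 2}"
  define D where "D = (\<lambda>(x, q). V x - V (descent_step X V x q))"
  define W where "W = (\<lambda>(x, q::real^'n). V x - V xbar)"
  have g0: "gradient V xbar = 0" using grad by (simp add: size_function_def)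
  obtain \<alpha> where \<alpha>: "pos_def_fun \<alpha>" "\<And>i. i \<in> I \<Longrightarrow> \<alpha> (W i) \<le> D i"
  proof (rule pos_def_lower_bound[of I D "(xbar, 0)" W])
    show "\<exists>c>0. \<forall>i\<in>I. a \<le> W i \<longrightarrow> W i \<le> b \<longrightarrow> c \<le> D i" if "0 < a" for a b
      using descent_step_decrease_on_shell[OF assms(1) diff assms(6) size grad that, of b]
      by (auto simp: I_def D_def W_def)
  qed (use descent_step_le[OF size] xbar g0 in \<open>auto simp: I_def D_def W_def descent_step_def\<close>)
  obtain b where b: "b > 0" "\<And>x u. x \<in> X \<Longrightarrow> norm (B x *v u) \<le> b * norm u"
    using bounded_matrix_family_norm_le[OF assms(8)] by blast
  obtain \<kappa> where \<kappa>: "class_K_inf \<kappa>" "\<And>x. x \<in> X \<Longrightarrow> \<omega> x \<le> \<kappa> (norm (gradient V x))"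
    using size_function_comparison[OF grad assms(3) xbar] by blast
  \<comment> \<open>Chosen so that \<open>\<rho> (norm u) \<le> \<omega> x\<close> forces
    \<open>2 * b * norm u \<le> norm (gradient V x)\<close>, by strict monotonicity of
    \<open>\<kappa>\<close>; then \<open>B x *v u\<close> has at most half the norm of the
    gradient.\<close>
  define \<rho> where "\<rho> r = \<kappa> ((2 * b) * r)" for r
  have \<rho>: "class_K_inf \<rho>"
    unfolding \<rho>_def using b(1) by (intro class_K_inf_compose[OF \<kappa>(1)] class_K_inf_mult) simp
  have "V (f x u) - V x \<le> - \<alpha> (V x - V xbar)" if x: "x \<in> X" and u: "\<rho> (norm u) \<le> \<omega> x" for x u
  proof -
    have "2 * b * norm u \<le> norm (gradient V x)"
    proof (rule ccontr)
      assume "\<not> 2 * b * norm u \<le> norm (gradient V x)"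
      then have "\<kappa> (norm (gradient V x)) < \<rho> (norm u)"
        unfolding \<rho>_def using \<kappa>(1) by (intro class_K_strict[of \<kappa>]) (auto simp: class_K_inf_def)
      then show False using \<kappa>(2)[OF x] u by simp
    qed
    then have "(x, B x *v u) \<in> I" using b(2)[OF x, of u] x by (simp add: I_def)
    from \<alpha>(2)[OF this] show ?thesis by (simp add: W_def D_def f[OF x])
  qed
  then have "ISS_Lyapunov_function X xbar \<omega> f V"
    unfolding ISS_Lyapunov_function_def
    using size_function_shift_continuous[OF size] size \<alpha>(1) \<rho> by blast
  moreover from this have "ISS X \<omega> f"
    by (rule ISS_if_nonincreasing_Lyapunov[OF xbar assms(3)])
      (simp_all add: f descent_step_in[OF size] descent_step_le[OF size])
  ultimately show ?thesis by blast
qed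

end
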